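(* Let $0\le p<1$. Consider a row of $n\ge1$ seats with a single entrance, filled by $p$-courteous theatregoers choosing seats according to the left-biased geometric distribution (model described in the context). The expected number of occupied seats when the process ends equals $$\sum_{l=1}^n\prod_{k=1}^{l-1}\left(p+\frac{1-p}{2^k}\right).$$ Moreover, the limit $T_p$ of this expression as $n\to\infty$ satisfies $$\frac{1.6396-0.6425\,p}{1-p}\le T_p\le\frac{1.7096-0.6425\,p}{1-p}$$ for all $0\le p<1$.
   Context: Row model: a row of $n$ seats with a single entrance at one end. Theatregoers arrive one at a time; each is, independently, courteous with probability $p$ and selfish with probability $1-p$, and this status never changes. A seated selfish theatregoer never gets up, so no later theatregoer can walk past her seat; a seated courteous theatregoer never blocks. An empty seat is accessible if it can be reached from the entrance without passing a seat occupied by a selfish theatregoer. When there are $m\ge1$ accessible empty seats, labelled $1,\dots,m$ in increasing order of distance from the entrance, the arriving theatregoer sits in the $j$-th one with probability $2^{-j}$ for $j=1,\dots,m-1$ and with probability $2^{-(m-1)}$ for $j=m$ (left-biased geometric distribution). The process ends when no accessible empty seat remains. *)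

theory Defs
  imports "HOL-Probability.Probability"
begin

datatype seat = Empty | Courteous | Selfish

text \<open>
  A row is a list of seats; index 0 is the seat next to the entrance. The accessible empty seats
  are listed in increasing order of distance from the entrance, so the seat labelled \<open>j\<close> is
  \<open>accessible_seats s ! (j - 1)\<close>.
\<close>

definition accessible :: "seat list \<Rightarrow> nat \<Rightarrow> bool" where
  "accessible s i \<longleftrightarrow> s ! i = Empty \<and> (\<forall>k<i. s ! k \<noteq> Selfish)"

definition accessible_seats :: "seat list \<Rightarrow> nat list" where
  "accessible_seats s = filter (accessible s) [0..<length s]"

text \<open>Only meaningful for \<open>m \<ge> 1\<close>, see \<open>pmf_left_biased_geometric\<close>.\<close>

definition left_biased_geometric :: "nat \<Rightarrow> nat pmf" where
  "left_biased_geometric m =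
     embed_pmf (\<lambda>j. if 1 \<le> j \<and> j < m then 1 / 2 ^ j
                    else if j = m then 1 / 2 ^ (m - 1) else 0)"

lemma left_biased_geometric_sum:
  assumes "m \<ge> 1"
  shows "(\<Sum>j=1..m. if 1 \<le> j \<and> j < m then 1 / 2 ^ j
            else if j = m then 1 / 2 ^ (m - 1) else 0 :: real) = 1"
proof -
  obtain k where m: "m = Suc k" using assms by (cases m) auto
  have geo: "(\<Sum>j=1..k. 1 / 2 ^ j :: real) = 1 - 1 / 2 ^ k"
    by (induction k) (auto simp: field_simps)
  have "(\<Sum>j=1..m. if 1 \<le> j \<and> j < m then 1 / 2 ^ j
            else if j = m then 1 / 2 ^ (m - 1) else 0 :: real)
        = (\<Sum>j=1..k. 1 / 2 ^ j) + 1 / 2 ^ k"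
    unfolding m by (auto intro!: sum.cong)
  with geo show ?thesis by simp
qed

lemma pmf_left_biased_geometric:
  assumes "m \<ge> 1"
  shows "pmf (left_biased_geometric m) j =
     (if 1 \<le> j \<and> j < m then 1 / 2 ^ j else if j = m then 1 / 2 ^ (m - 1) else 0)"
  unfolding left_biased_geometric_def
proof (rule pmf_embed_pmf)
  let ?f = "\<lambda>j. if 1 \<le> j \<and> j < m then 1 / 2 ^ j
                    else if j = m then 1 / 2 ^ (m - 1) else 0 :: real"
  show "0 \<le> ?f j" for j by simp
  have "(\<integral>\<^sup>+j. ennreal (?f j) \<partial>count_space UNIV) = (\<Sum>j=1..m. ennreal (?f j))"
    using assms by (intro nn_integral_count_space') (auto split: if_splits)
  also have "\<dots> = ennreal (\<Sum>j=1..m. ?f j)"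
    by (intro sum_ennreal) simp
  also have "\<dots> = 1"
    using left_biased_geometric_sum[OF assms] by simp
  finally show "(\<integral>\<^sup>+j. ennreal (?f j) \<partial>count_space UNIV) = 1" .
qed

lemma set_pmf_left_biased_geometric:
  assumes "m \<ge> 1"
  shows "set_pmf (left_biased_geometric m) = {1..m}"
  using assms by (auto simp: set_pmf_eq pmf_left_biased_geometric split: if_splits)

text \<open>One arrival; used only for rows with at least one accessible empty seat.\<close>

definition arrival :: "real \<Rightarrow> seat list \<Rightarrow> seat list pmf" where
  "arrival p s =
     do {
       j \<leftarrow> left_biased_geometric (length (accessible_seats s));
       courteous \<leftarrow> bernoulli_pmf p;
       return_pmf (s[accessible_seats s ! (j - 1) := (if courteous then Courteous else Selfish)])
     }"

definition num_occupied :: "seat list \<Rightarrow> nat" where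
  "num_occupied s = card {i. i < length s \<and> s ! i \<noteq> Empty}"

lemma arrival_empty_seats_less:
  assumes "accessible_seats s \<noteq> []" and t: "t \<in> set_pmf (arrival p s)"
  shows "card {i. i < length t \<and> t ! i = Empty} < card {i. i < length s \<and> s ! i = Empty}"
proof -
  have m: "length (accessible_seats s) \<ge> 1"
    using assms(1) by (cases "accessible_seats s") auto
  from t obtain j courteous where j: "j \<in> {1..length (accessible_seats s)}"
    and "t = s[accessible_seats s ! (j - 1) := (if courteous then Courteous else Selfish)]"
    unfolding arrival_def set_bind_pmf set_pmf_left_biased_geometric[OF m] set_return_pmf
    by blast
  moreover define c where "c = (if courteous then Courteous else Selfish)"
  ultimately have c: "c \<noteq> Empty" and t_eq: "t = s[accessible_seats s ! (j - 1) := c]"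
    by auto
  define i where "i = accessible_seats s ! (j - 1)"
  have "i \<in> set (accessible_seats s)"
    unfolding i_def using j by (intro nth_mem) auto
  then have i: "i < length s" "s ! i = Empty"
    by (auto simp: accessible_seats_def accessible_def)
  have "{k. k < length t \<and> t ! k = Empty} \<subset> {k. k < length s \<and> s ! k = Empty}"
    using i c unfolding t_eq i_def[symmetric] by (auto simp: nth_list_update)
  then show ?thesis by (intro psubset_card_mono) auto
qed

text \<open>Distribution of the row when the process, started from the row \<open>s\<close>, ends.\<close>

function final_row :: "real \<Rightarrow> seat list \<Rightarrow> seat list pmf" where
  "final_row p s =
     (if accessible_seats s = [] then return_pmf s
      else bind_pmf (arrival p s) (final_row p))"
  by pat_completeness auto
termination
  by (relation "inv_image less_than (\<lambda>(p, s). card {i. i < length s \<and> s ! i = Empty})")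
     (simp_all add: arrival_empty_seats_less)

declare final_row.simps [simp del]

definition expected_occupied :: "real \<Rightarrow> nat \<Rightarrow> real" where
  "expected_occupied p n =
     measure_pmf.expectation (final_row p (replicate n Empty)) (\<lambda>s. real (num_occupied s))"

end

theory Submission
  imports Defs
begin

text \<open>
  With \<open>m\<close> accessible seats left, a courteous arrival leaves \<open>m - 1\<close> of them and a selfish one in
  the \<open>j\<close>-th leaves \<open>j - 1\<close>; hence the expected number \<open>F m\<close> of further arrivals satisfies a
  recursion, whose first difference is \<open>F (m + 1) - F m = (p + (1 - p) / 2 ^ m) (F m - F (m - 1))\<close>.

  For the bounds, let \<open>w l\<close> be the product of the first \<open>l\<close> factors and \<open>S x = (\<Sum>l. w l * x ^ l)\<close>.
  The recursion for \<open>w\<close> gives \<open>S x = 1 + x (p S x + (1 - p) / 2 * S (x / 2))\<close>. Using it at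
  \<open>x = 1, 1/2, 1/4, 1/8\<close> expresses \<open>(1 - p) S 1\<close> through \<open>S (1/16)\<close>, which is crudely
  estimated by a geometric series; what remains are polynomial inequalities in \<open>1 - p\<close>.
\<close>

definition courtesy_prod :: "real \<Rightarrow> nat \<Rightarrow> real" where
  "courtesy_prod p l = (\<Prod>k=1..l. p + (1 - p) / 2 ^ k)"

lemma courtesy_prod_0 [simp]: "courtesy_prod p 0 = 1"
  by (simp add: courtesy_prod_def)

lemma courtesy_prod_Suc:
  "courtesy_prod p (Suc l) = (p + (1 - p) / 2 ^ Suc l) * courtesy_prod p l"
  by (simp add: courtesy_prod_def)

lemma sum_courtesy_prod_eq:
  "(\<Sum>l=1..n. \<Prod>k=1..l-1. (p + (1 - p) / 2 ^ k)) = (\<Sum>l<n. courtesy_prod p l)"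
  by (simp add: courtesy_prod_def sum.atLeast1_atMost_eq)

section \<open>The expected number of occupied seats\<close>

lemma set_accessible_seats: "set (accessible_seats s) = {i. i < length s \<and> accessible s i}"
  by (auto simp: accessible_seats_def)

lemma sorted_wrt_accessible_seats: "sorted_wrt (<) (accessible_seats s)"
  by (simp add: accessible_seats_def sorted_wrt_filter)

lemma length_accessible_seats:
  "length (accessible_seats s) = card {i. i < length s \<and> accessible s i}"
proof -
  have "distinct (accessible_seats s)" by (simp add: accessible_seats_def)
  then show ?thesis by (simp add: set_accessible_seats flip: distinct_card)
qed

text \<open>Used to count the accessible seats nearer to the entrance than a given one; exactly
  these survive when a selfish arrival takes it.\<close>

lemma card_less_nth_sorted:
  fixes xs :: "'a::linorder list"
  assumes "sorted_wrt (<) xs" "a < length xs"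
  shows "card {x \<in> set xs. x < xs ! a} = a"
proof -
  have less: "xs ! i < xs ! j \<longleftrightarrow> i < j" if "i < length xs" "j < length xs" for i j
    using assms(1) that by (metis less_asym linorder_neqE_nat order.irrefl sorted_wrt_nth_less)
  have "{x \<in> set xs. x < xs ! a} \<subseteq> (!) xs ` {..<a}"
    using assms(2) less by (auto simp: in_set_conv_nth)
  moreover have "(!) xs ` {..<a} \<subseteq> {x \<in> set xs. x < xs ! a}"
    using assms(2) less by auto
  ultimately have "{x \<in> set xs. x < xs ! a} = (!) xs ` {..<a}" ..
  moreover have "inj_on ((!) xs) {..<a}"
    using assms(2) less by (intro inj_onI) (metis lessThan_iff less_trans linorder_neqE_nat order.irrefl)
  ultimately show ?thesis by (simp add: card_image)
qed

text \<open>A courteous arrival creates no new \<open>Selfish\<close> seat, so no other seat changes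
  its accessibility.\<close>

lemma length_accessible_seats_courteous:
  assumes "i \<in> set (accessible_seats s)"
  shows "length (accessible_seats (s[i := Courteous])) = length (accessible_seats s) - 1"
proof -
  have i: "i < length s" "s ! i = Empty"
    using assms by (auto simp: set_accessible_seats accessible_def)
  then have "s[i := Courteous] ! k = Selfish \<longleftrightarrow> s ! k = Selfish" for k
    by (cases "k = i") auto
  then have "{k. k < length s \<and> accessible (s[i := Courteous]) k}
      = {k. k < length s \<and> accessible s k} - {i}"
    using i by (auto simp: accessible_def nth_list_update)
  then show ?thesis
    using assms by (simp add: length_accessible_seats set_accessible_seats card_Diff_singleton)
qed

text \<open>The new occupant cuts off every seat behind her and leaves the nearer ones as they were.
  Since \<open>a\<close> counts from 0, the seat labelled \<open>j\<close> leaves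
  \<open>j - 1\<close>.\<close>

lemma length_accessible_seats_selfish:
  assumes "a < length (accessible_seats s)"
  shows "length (accessible_seats (s[accessible_seats s ! a := Selfish])) = a"
proof -
  define i where "i = accessible_seats s ! a"
  have "i \<in> set (accessible_seats s)" using assms by (simp add: i_def)
  then have i: "i < length s" "s ! i = Empty" "\<forall>k<i. s ! k \<noteq> Selfish"
    by (auto simp: set_accessible_seats accessible_def)
  have "accessible (s[i := Selfish]) k \<longleftrightarrow> accessible s k \<and> k < i" if "k < length s" for k
  proof (cases "k < i")
    case True
    then show ?thesis using i by (auto simp: accessible_def)
  next
    case False
    then show ?thesis using i that
      by (cases "k = i") (auto simp: accessible_def intro!: exI[of _ i])
  qed
  then have "{k. k < length s \<and> accessible (s[i := Selfish]) k}
      = {k \<in> set (accessible_seats s). k < i}"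
    by (auto simp: set_accessible_seats)
  then show ?thesis
    using card_less_nth_sorted[OF sorted_wrt_accessible_seats assms]
    by (simp add: length_accessible_seats[of "s[_ := _]"] i_def)
qed

lemma num_occupied_update:
  assumes "i < length s" "s ! i = Empty" "c \<noteq> Empty"
  shows "num_occupied (s[i := c]) = Suc (num_occupied s)"
proof -
  have "{k. k < length s \<and> s[i := c] ! k \<noteq> Empty} = insert i {k. k < length s \<and> s ! k \<noteq> Empty}"
    using assms by (auto simp: nth_list_update)
  then show ?thesis using assms by (simp add: num_occupied_def)
qed

lemma num_occupied_le: "num_occupied s \<le> length s"
  unfolding num_occupied_def using card_mono[of "{..<length s}" "{i. i < length s \<and> s ! i \<noteq> Empty}"]
  by auto

section \<open>First-step analysis of the expectation\<close>

lemma finite_set_pmf_arrival: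
  assumes "accessible_seats s \<noteq> []"
  shows "finite (set_pmf (arrival p s))"
proof -
  have "length (accessible_seats s) \<ge> 1" using assms by (cases "accessible_seats s") auto
  then show ?thesis by (simp add: arrival_def set_pmf_left_biased_geometric)
qed

text \<open>Finite support is what \<open>pmf_expectation_bind\<close> needs to turn expectations
  into finite sums.\<close>

lemma finite_set_pmf_final_row: "finite (set_pmf (final_row p s))"
proof (induction p s rule: final_row.induct)
  case (1 p s)
  show ?case
  proof (cases "accessible_seats s = []")
    case True
    then show ?thesis by (simp add: final_row.simps)
  next
    case False
    then show ?thesis
      using 1 finite_set_pmf_arrival[OF False, of p] by (subst final_row.simps) auto
  qed
qed

lemma sum_left_biased_geometric:
  assumes "m \<ge> 1"
  shows "(\<Sum>j=1..m. pmf (left_biased_geometric m) j * f j)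
    = (\<Sum>j=1..<m. f j / 2 ^ j) + f m / 2 ^ (m - 1)"
proof -
  have "{1..m} = insert m {1..<m}" using assms by auto
  then show ?thesis
    using assms by (simp add: pmf_left_biased_geometric)
qed

text \<open>Passing from \<open>m\<close> to \<open>m + 1\<close> splits the weight
  \<open>1 / 2 ^ m\<close> of the last seat into two halves, one on \<open>F m\<close> and one on
  \<open>F (m + 1)\<close>. The right-hand side thus grows by
  \<open>(p + (1 - p) / 2 ^ (m + 1)) * (F (m + 1) - F m)\<close>, which is the defining step of
  \<open>courtesy_prod\<close>.\<close>

lemma courtesy_recursion:
  fixes p :: real and F :: "nat \<Rightarrow> real"
  defines "F \<equiv> \<lambda>m. \<Sum>l<m. courtesy_prod p l"
  shows "F (Suc m) = 1 + p * F m
    + (1 - p) * ((\<Sum>j=1..<Suc m. F (j - 1) / 2 ^ j) + F m / 2 ^ m)"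
proof (induction m)
  case 0
  then show ?case by (simp add: F_def)
next
  case (Suc m)
  define r :: real where "r = 1 / 2 ^ Suc m"
  define G where "G = (\<Sum>j=1..<Suc m. F (j - 1) / 2 ^ j)"
  have "F (Suc (Suc m)) = F (Suc m) + (p + (1 - p) * r) * (F (Suc m) - F m)"
    by (simp add: F_def courtesy_prod_Suc r_def)
  moreover have "F (Suc m) = 1 + p * F m + (1 - p) * (G + F m * (2 * r))"
    using Suc by (simp add: r_def G_def)
  moreover have "(\<Sum>j=1..<Suc (Suc m). F (j - 1) / 2 ^ j) = G + F m * r"
    unfolding G_def r_def by (subst sum.atLeastLessThan_Suc) simp_all
  moreover have "F (Suc m) / 2 ^ Suc m = F (Suc m) * r" by (simp add: r_def)
  ultimately show ?case by (simp only:) (simp add: algebra_simps)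
qed

text \<open>Stated for an arbitrary row because the row is no longer empty after one arrival.
  Conditioning on that arrival works since the future depends only on the number of accessible
  seats; the induction is on the number of empty seats.\<close>

lemma expectation_final_row:
  fixes p :: real and F :: "nat \<Rightarrow> real"
  assumes p: "0 \<le> p" "p \<le> 1"
  defines "F \<equiv> \<lambda>m. \<Sum>l<m. courtesy_prod p l"
  shows "measure_pmf.expectation (final_row p s) (\<lambda>s. real (num_occupied s))
    = real (num_occupied s) + F (length (accessible_seats s))"
proof (induction "length s - num_occupied s" arbitrary: s rule: less_induct)
  case less
  let ?E = "\<lambda>s. measure_pmf.expectation (final_row p s) (\<lambda>s. real (num_occupied s))"
  define m where "m = length (accessible_seats s)"
  show ?case
  proof (cases "m = 0")
    case True
    then show ?thesis by (simp add: m_def final_row.simps F_def)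
  next
    case False
    then have m: "m \<ge> 1" by simp
    define t where
      "t j c = s[accessible_seats s ! (j - 1) := (if c then Courteous else Selfish)]" for j c
    have E_t: "?E (t j c) = 1 + real (num_occupied s) + F (if c then m - 1 else j - 1)"
      if "j \<in> {1..m}" for j c
    proof -
      have j: "j - 1 < length (accessible_seats s)" using that m_def by auto
      define i where "i = accessible_seats s ! (j - 1)"
      have i_mem: "i \<in> set (accessible_seats s)" using j by (simp add: i_def)
      then have "i < length s" "s ! i = Empty"
        by (auto simp: set_accessible_seats accessible_def)
      then have occ: "num_occupied (t j c) = Suc (num_occupied s)"
        unfolding t_def i_def[symmetric] by (simp add: num_occupied_update)
      have "length (t j c) = length s" by (simp add: t_def)
      \<comment> \<open>Subtraction on naturals truncates; \<open>num_occupied_le\<close> for the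
        new row shows that \<open>s\<close> still had an empty seat, so the decrease is
        strict.\<close>
      then have "length (t j c) - num_occupied (t j c) < length s - num_occupied s"
        using num_occupied_le[of "t j c"] occ by simp
      moreover have "length (accessible_seats (t j c)) = (if c then m - 1 else j - 1)"
        using length_accessible_seats_courteous[OF i_mem] length_accessible_seats_selfish[OF j]
        by (simp add: t_def m_def i_def)
      ultimately show ?thesis using less occ by simp
    qed
    have E_bernoulli: "measure_pmf.expectation (bernoulli_pmf p \<bind> (\<lambda>c. final_row p (t j c)))
        (\<lambda>s. real (num_occupied s)) = p * ?E (t j True) + (1 - p) * ?E (t j False)" for j
      using p by (subst pmf_expectation_bind[of UNIV])
        (auto simp: finite_set_pmf_final_row UNIV_bool)
    have "final_row p s =
        left_biased_geometric m \<bind> (\<lambda>j. bernoulli_pmf p \<bind> (\<lambda>c. final_row p (t j c)))"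
      using False by (subst final_row.simps)
        (simp add: m_def arrival_def bind_assoc_pmf bind_return_pmf t_def)
    then have "?E s = (\<Sum>j=1..m. pmf (left_biased_geometric m) j *
        measure_pmf.expectation (bernoulli_pmf p \<bind> (\<lambda>c. final_row p (t j c)))
          (\<lambda>s. real (num_occupied s)))"
      using m by (simp add: pmf_expectation_bind[of "{1..m}"] finite_set_pmf_final_row
          set_pmf_left_biased_geometric)
    also have "\<dots> = (\<Sum>j=1..m. pmf (left_biased_geometric m) j *
        (p * ?E (t j True) + (1 - p) * ?E (t j False)))"
      by (simp only: E_bernoulli)
    also have "\<dots> = (\<Sum>j=1..m. pmf (left_biased_geometric m) j *
        ((1 + real (num_occupied s) + p * F (m - 1)) + (1 - p) * F (j - 1)))"
      by (intro sum.cong refl) (simp add: E_t algebra_simps)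
    \<comment> \<open>The courteous outcome does not depend on the chosen seat, so it is weighted by
      the total mass 1.\<close>
    also have "\<dots> = (\<Sum>j=1..m. pmf (left_biased_geometric m) j) *
        (1 + real (num_occupied s) + p * F (m - 1)) +
        (1 - p) * (\<Sum>j=1..m. pmf (left_biased_geometric m) j * F (j - 1))"
      by (simp only: distrib_left sum.distrib sum_distrib_left sum_distrib_right mult_ac)
    also have "(\<Sum>j=1..m. pmf (left_biased_geometric m) j) = 1"
      using m by (intro sum_pmf_eq_1) (simp_all add: set_pmf_left_biased_geometric)
    also have "(\<Sum>j=1..m. pmf (left_biased_geometric m) j * F (j - 1))
        = (\<Sum>j=1..<m. F (j - 1) / 2 ^ j) + F (m - 1) / 2 ^ (m - 1)"
      by (rule sum_left_biased_geometric[OF m])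
    finally have "?E s = real (num_occupied s) + (1 + p * F (m - 1) + (1 - p) *
        ((\<Sum>j=1..<m. F (j - 1) / 2 ^ j) + F (m - 1) / 2 ^ (m - 1)))"
      by simp
    also have "1 + p * F (m - 1) + (1 - p) *
        ((\<Sum>j=1..<m. F (j - 1) / 2 ^ j) + F (m - 1) / 2 ^ (m - 1)) = F m"
    proof -
      have "Suc (m - 1) = m" using m by simp
      then show ?thesis
        using courtesy_recursion[of p "m - 1"] unfolding F_def by (simp only:)
    qed
    finally show ?thesis by (simp only: m_def)
  qed
qed

lemma expected_occupied_eq:
  assumes "0 \<le> p" "p \<le> 1"
  shows "expected_occupied p n = (\<Sum>l<n. courtesy_prod p l)"
proof -
  have "{i. i < n \<and> accessible (replicate n Empty) i} = {..<n}"
    by (auto simp: accessible_def)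
  then have "length (accessible_seats (replicate n Empty)) = n"
    by (simp add: length_accessible_seats)
  moreover have "num_occupied (replicate n Empty) = 0"
    by (simp add: num_occupied_def)
  ultimately show ?thesis
    by (simp add: expected_occupied_def expectation_final_row[OF assms])
qed

section \<open>The limit\<close>

text \<open>The first factor \<open>(1 + p) / 2\<close> is the largest and is below 1, which gives a
  geometric majorant and hence convergence even at \<open>x = 1\<close>.\<close>

lemma courtesy_prod_bounds:
  assumes "0 \<le> p" "p < 1"
  shows "0 \<le> courtesy_prod p l \<and> courtesy_prod p l \<le> ((1 + p) / 2) ^ l"
proof (induction l)
  case 0
  then show ?case by simp
next
  case (Suc l)
  have "(1 - p) / 2 ^ Suc l \<le> (1 - p) / 2"
    using assms by (intro divide_left_mono) simp_all
  moreover have "p + (1 - p) / 2 = (1 + p) / 2" by (simp add: field_simps)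
  ultimately have "p + (1 - p) / 2 ^ Suc l \<le> (1 + p) / 2" by linarith
  moreover have "0 \<le> p + (1 - p) / 2 ^ Suc l" using assms by simp
  ultimately show ?case
    unfolding courtesy_prod_Suc power_Suc[of "(1 + p) / 2"] using Suc assms
    by (intro conjI mult_mono mult_nonneg_nonneg) auto
qed

section \<open>The generating function and the numerical bounds\<close>

definition courtesy_series :: "real \<Rightarrow> real \<Rightarrow> real" where
  "courtesy_series p x = (\<Sum>l. courtesy_prod p l * x ^ l)"

lemma summable_courtesy:
  assumes "0 \<le> p" "p < 1" "0 \<le> x" "x \<le> 1"
  shows "summable (\<lambda>l. courtesy_prod p l * x ^ l)"
proof (rule summable_comparison_test)
  show "\<exists>N. \<forall>l\<ge>N. norm (courtesy_prod p l * x ^ l) \<le> ((1 + p) / 2) ^ l"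
  proof (intro exI allI impI)
    fix l
    have "courtesy_prod p l * x ^ l \<le> ((1 + p) / 2) ^ l * 1"
      using assms courtesy_prod_bounds[of p l] by (intro mult_mono) (auto simp: power_le_one)
    then show "norm (courtesy_prod p l * x ^ l) \<le> ((1 + p) / 2) ^ l"
      using assms courtesy_prod_bounds[of p l] by simp
  qed
  show "summable (\<lambda>l. ((1 + p) / 2) ^ l)" using assms by (intro summable_geometric) simp
qed

text \<open>The factor \<open>1 / 2 ^ Suc l\<close> is absorbed into the power of \<open>x\<close>;
  this is what halves the argument.\<close>

lemma courtesy_series_recursion:
  assumes "0 \<le> p" "p < 1" "0 \<le> x" "x \<le> 1"
  shows "(1 - p * x) * courtesy_series p x = 1 + (1 - p) * (x / 2) * courtesy_series p (x / 2)"
proof -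
  let ?w = "courtesy_prod p"
  note summable = summable_courtesy[OF assms] summable_courtesy[OF assms(1,2), of "x / 2"]
  have "?w (Suc l) * x ^ Suc l = p * x * (?w l * x ^ l) + (1 - p) * (x / 2) * (?w l * (x / 2) ^ l)"
    for l by (simp add: courtesy_prod_Suc power_divide field_simps)
  moreover have "(\<lambda>l. p * x * (?w l * x ^ l) + (1 - p) * (x / 2) * (?w l * (x / 2) ^ l))
      sums (p * x * courtesy_series p x + (1 - p) * (x / 2) * courtesy_series p (x / 2))"
    unfolding courtesy_series_def using summable assms
    by (intro sums_add sums_mult summable_sums) auto
  ultimately have "(\<Sum>l. ?w (Suc l) * x ^ Suc l)
      = p * x * courtesy_series p x + (1 - p) * (x / 2) * courtesy_series p (x / 2)"
    by (simp only: sums_unique[symmetric])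
  moreover have "courtesy_series p x = ?w 0 * x ^ 0 + (\<Sum>l. ?w (Suc l) * x ^ Suc l)"
    unfolding courtesy_series_def using suminf_split_head[OF summable(1)] by simp
  ultimately show ?thesis by (simp add: algebra_simps)
qed

lemma courtesy_series_bounds:
  assumes "0 \<le> p" "p < 1" "0 \<le> x" "x < 1"
  shows "0 \<le> courtesy_series p x" "courtesy_series p x \<le> 1 / (1 - x)"
proof -
  have summable: "summable (\<lambda>l. courtesy_prod p l * x ^ l)"
    using assms by (intro summable_courtesy) auto
  show "0 \<le> courtesy_series p x"
    unfolding courtesy_series_def
    using assms courtesy_prod_bounds[of p] by (intro suminf_nonneg summable) simp
  have "courtesy_prod p l * x ^ l \<le> x ^ l" for l
  proof -
    have "((1 + p) / 2) ^ l \<le> 1" using assms by (intro power_le_one) auto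
    then have "courtesy_prod p l \<le> 1" using assms courtesy_prod_bounds[of p l] by linarith
    then show ?thesis
      using assms courtesy_prod_bounds[of p l] by (intro mult_left_le_one_le) auto
  qed
  then have "courtesy_series p x \<le> (\<Sum>l. x ^ l)"
    unfolding courtesy_series_def using assms
    by (intro suminf_le summable summable_geometric) auto
  also have "\<dots> = 1 / (1 - x)" using assms by (intro suminf_geometric) simp
  finally show "courtesy_series p x \<le> 1 / (1 - x)" .
qed

text \<open>Here \<open>q\<close> stands for \<open>1 - p\<close>, \<open>g\<close> for
  \<open>q * S 1\<close>, and \<open>a\<close>, \<open>b\<close>, \<open>c\<close>, \<open>d\<close>
  for \<open>x * S x\<close> at \<open>x = 1/2, 1/4, 1/8, 1/16\<close>. Multiplying by
  \<open>?D\<close> eliminates \<open>a\<close>, \<open>b\<close>, \<open>c\<close> and leaves a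
  polynomial in \<open>q\<close> plus \<open>q ^ 4 * d\<close>.\<close>

lemma nested_fraction_bounds:
  fixes q a b c d g :: real
  assumes q: "0 < q" "q \<le> 1" and d: "0 \<le> d" "d \<le> 1 / 15"
    and g: "g = 1 + q * a" and a: "(1 + q) * a = 1 + q * b"
    and b: "(3 + q) * b = 1 + q * c" and c: "(7 + q) * c = 1 + q * d"
  shows "0.9971 + 0.6425 * q \<le> g" "g \<le> 1.0671 + 0.6425 * q"
proof -
  let ?D = "(1 + q) * (3 + q) * (7 + q)"
  have D: "?D > 0" using q by simp
  have "?D * g = ?D + q * ((3 + q) * (7 + q) * ((1 + q) * a))"
    unfolding g by (simp add: algebra_simps)
  also have "\<dots> = ?D + q * ((3 + q) * (7 + q) + (7 + q) * q * ((3 + q) * b))"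
    unfolding a by (simp add: algebra_simps)
  also have "\<dots> = ?D + q * ((3 + q) * (7 + q) + q * (7 + q) + q ^ 2 * ((7 + q) * c))"
    unfolding b by (simp add: algebra_simps power2_eq_square)
  finally have Dg: "?D * g = ?D + q * ((3 + q) * (7 + q)) + q ^ 2 * (7 + q) + q ^ 3 + q ^ 4 * d"
    unfolding c by (simp add: algebra_simps eval_nat_numeral)
  have pow: "q ^ 2 \<le> q" "q ^ 3 \<le> q" "q ^ 4 \<le> q"
    using q power_decreasing[of 1 _ q] by auto
  have qd: "0 \<le> q ^ 4 * d" "q ^ 4 * d \<le> q ^ 4 * (1 / 15)" "0 \<le> q ^ 4"
    using q d by (auto intro: mult_left_mono)
  \<comment> \<open>The negative coefficients add up to 75927, less than 75974, so bounding each
    higher power by \<open>q\<close> suffices.\<close>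
  have "0 \<le> (609 + 75974 * q - 28856 * q ^ 2 - 40646 * q ^ 3 - 6425 * q ^ 4) / 10000 + q ^ 4 * d"
    using pow qd q by argo
  also have "\<dots> = ?D * g - ?D * (0.9971 + 0.6425 * q)"
    unfolding Dg by (simp add: field_simps eval_nat_numeral)
  finally have "?D * (0.9971 + 0.6425 * q) \<le> ?D * g"
    by (simp only: diff_ge_0_iff_ge)
  then show "0.9971 + 0.6425 * q \<le> g" using D by (simp only: mult_le_cancel_left_pos)
  \<comment> \<open>The difference is nearly tangent to zero close to \<open>q = 0.43\<close>.\<close>
  have "0 \<le> (q - 43/100)\<^sup>2 * (q + 86/100)"
    using q by simp
  \<comment> \<open>Taking the second factor as \<open>q\<close> plus twice 43/100 removes the
    quadratic term.\<close>
  also have "\<dots> = q ^ 3 - 5547 / 10000 * q + 159014 / 1000000"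
    by (simp add: field_simps eval_nat_numeral)
  finally have cubic: "0 \<le> q ^ 3 - 5547 / 10000 * q + 159014 / 1000000" .
  have "0 \<le> (q - 43/100)\<^sup>2"
    by simp
  also have "\<dots> = q ^ 2 - 86 / 100 * q + 1849 / 10000"
    by (simp add: field_simps eval_nat_numeral)
  finally have square: "0 \<le> q ^ 2 - 86 / 100 * q + 1849 / 10000" .
  \<comment> \<open>As \<open>d\<close> is at most 1/15, the terms in \<open>q ^ 4\<close> are
    together nonnegative. Subtracting 36556 times \<open>square\<close> and 41346 times
    \<open>cubic\<close> cancels the quadratic and cubic terms and leaves a positive constant and a
    positive multiple of \<open>q\<close>.\<close>
  have "0 \<le> (14091 - 54274 * q + 36556 * q ^ 2 + 41346 * q ^ 3 + 6425 * q ^ 4) / 10000 - q ^ 4 * d"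
    using qd q cubic square by argo
  also have "\<dots> = ?D * (1.0671 + 0.6425 * q) - ?D * g"
    unfolding Dg by (simp add: field_simps eval_nat_numeral)
  finally have "?D * g \<le> ?D * (1.0671 + 0.6425 * q)"
    by (simp only: diff_ge_0_iff_ge)
  then show "g \<le> 1.0671 + 0.6425 * q" using D by (simp only: mult_le_cancel_left_pos)
qed

theorem theorem5:
  fixes p :: real
  assumes "0 \<le> p" and "p < 1"
  shows "(\<forall>n\<ge>1. expected_occupied p n
            = (\<Sum>l=1..n. \<Prod>k=1..l-1. (p + (1 - p) / 2 ^ k)))
       \<and> (\<exists>T. (\<lambda>n. \<Sum>l=1..n. \<Prod>k=1..l-1. (p + (1 - p) / 2 ^ k)) \<longlonglongrightarrow> T
            \<and> (1.6396 - 0.6425 * p) / (1 - p) \<le> T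
            \<and> T \<le> (1.7096 - 0.6425 * p) / (1 - p))"
proof -
  let ?S = "courtesy_series p" and ?q = "1 - p"
  have lim: "(\<lambda>n. \<Sum>l<n. courtesy_prod p l) \<longlonglongrightarrow> ?S 1"
    using summable_LIMSEQ[OF summable_courtesy[OF assms, of 1]]
    by (simp add: courtesy_series_def)
  note rec = courtesy_series_recursion[OF assms]
  have "0 < ?q" "?q \<le> 1" "0 \<le> ?S (1/16) / 16" "?S (1/16) / 16 \<le> 1 / 15"
    using assms courtesy_series_bounds[OF assms, of "1/16"] by simp_all
  moreover have "?q * ?S 1 = 1 + ?q * (?S (1/2) / 2)"
    using rec[of 1] by simp
  \<comment> \<open>At \<open>x = 1 / 2 ^ k\<close> the coefficient \<open>1 - p * x\<close> equals
    \<open>(2 ^ k - 1 + ?q) / 2 ^ k\<close>, whence the constants 1, 3, 7.\<close>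
  moreover have "(1 + ?q) * (?S (1/2) / 2) = 1 + ?q * (?S (1/4) / 4)"
    using rec[of "1/2"] by (simp add: field_simps)
  moreover have "(3 + ?q) * (?S (1/4) / 4) = 1 + ?q * (?S (1/8) / 8)"
    using rec[of "1/4"] by (simp add: field_simps)
  moreover have "(7 + ?q) * (?S (1/8) / 8) = 1 + ?q * (?S (1/16) / 16)"
    using rec[of "1/8"] by (simp add: field_simps)
  ultimately have "0.9971 + 0.6425 * ?q \<le> ?q * ?S 1" "?q * ?S 1 \<le> 1.0671 + 0.6425 * ?q"
    by (rule nested_fraction_bounds)+
  \<comment> \<open>Substituting \<open>?q = 1 - p\<close> turns 0.9971 and 1.0671 into 1.6396 and
    1.7096, each larger by 0.6425.\<close>
  then have "(1.6396 - 0.6425 * p) / (1 - p) \<le> ?S 1" "?S 1 \<le> (1.7096 - 0.6425 * p) / (1 - p)"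
    using assms by (simp_all add: field_simps)
  then show ?thesis
    using lim expected_occupied_eq[of p] assms unfolding sum_courtesy_prod_eq by auto
qed

end
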